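(* Let $M$ be a timelike helicoidal surface of type I, II or III in the Lorentzian $n$-space $\mathbb{E}^n_1$, with translation constant $c>0$, and let $\alpha(u)={\bf x}(u,v(u))$ (where ${\bf x}$ is ${\bf x}_I$, ${\bf x}_{II}$ or ${\bf x}_{III}$, respectively) be a spacelike loxodrome on $M$ which makes the constant Lorentzian timelike angle $\theta_0$ with the meridians of $M$ and satisfies $v(u_0)=0$. Put $\Theta=\cosh\theta_0$ if $\varepsilon=1$ and $\Theta=\sinh\theta_0$ if $\varepsilon=-1$. Then $\alpha$ has the following parametrization, for one of the two choices of the sign $\pm$: (i) for the helicoidal surface of type I, $$\alpha_I(u)=(x_1(u)\cos v(u),\,x_1(u)\sin v(u),\,x_3(u),\dots,x_{n-1}(u),\,x_n(u)+cv(u)),$$ where $$v(u)=\int_{u_0}^u\frac{2c\,x_n'(\xi)(\Theta^2-\varepsilon)\pm\sqrt{\sinh^2 2\theta_0\,\bigl(c^2(\varepsilon+x_n'^2(\xi))-\varepsilon x_1^2(\xi)\bigr)}}{2\Theta^2(x_1^2(\xi)-c^2)-2c^2x_n'^2(\xi)}\,d\xi,$$ provided that $\Theta^2(x_1^2(\xi)-c^2)-c^2x_n'^2(\xi)\neq0$; (ii) for the helicoidal surface of type II, $$\alpha_{II}(u)=(x_1(u)+cv(u),\,x_2(u),\dots,x_{n-2}(u),\,x_n(u)\sinh v(u),\,x_n(u)\cosh v(u)),$$ where $$v(u)=\int_{u_0}^u\frac{-2c\,x_1'(\xi)(\Theta^2-\varepsilon)\pm\sqrt{\sinh^2 2\theta_0\,\bigl(c^2(x_1'^2(\xi)-\varepsilon)-\varepsilon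 x_n^2(\xi)\bigr)}}{2\Theta^2(c^2+x_n^2(\xi))-2c^2x_1'^2(\xi)}\,d\xi,$$ provided that $\Theta^2(c^2+x_n^2(\xi))-c^2x_1'^2(\xi)\neq0$; (iii) for the helicoidal surface of type III, $$\alpha_{III}(u)=x_1(u)e_1+\sqrt2\,v(u)x_n(u)e_2+x_3(u)e_3+\cdots+x_{n-2}(u)e_{n-2}+\bigl(x_{n-1}(u)+v^2(u)x_n(u)+cv(u)\bigr)\xi_{n-1}+x_n(u)\xi_n,$$ where $$v(u)=\int_{u_0}^u\frac{2c\,x_n'(\xi)(\Theta^2-\varepsilon)\pm\sqrt{\sinh^2 2\theta_0\,\bigl(c^2x_n'^2(\xi)-2\varepsilon x_n^2(\xi)\bigr)}}{4\Theta^2x_n^2(\xi)-2c^2x_n'^2(\xi)}\,d\xi,$$ provided that $2\Theta^2x_n^2(\xi)-c^2x_n'^2(\xi)\neq0$.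
   Context: **Lorentzian space.** $\mathbb{E}^n_1$ is $\mathbb{R}^n$ with $\langle x,y\rangle=x_1y_1+\cdots+x_{n-1}y_{n-1}-x_ny_n$, and $\|x\|=\sqrt{|\langle x,x\rangle|}$. A vector $x$ is spacelike if $\langle x,x\rangle>0$ or $x=0$, timelike if $\langle x,x\rangle<0$, lightlike if $\langle x,x\rangle=0$ and $x\ne0$. A smooth curve is spacelike if its velocity vectors are spacelike. Here $n\ge3$ for types I and II and $n\ge4$ for type III. $\{e_1,\dots,e_n\}$ is the standard orthonormal basis, and $\xi_{n-1}=\frac1{\sqrt2}(e_n-e_{n-1})$, $\xi_n=\frac1{\sqrt2}(e_n+e_{n-1})$, so that $\langle\xi_{n-1},\xi_{n-1}\rangle=\langle\xi_n,\xi_n\rangle=0$, $\langle\xi_{n-1},\xi_n\rangle=-1$. **Surfaces.** For a surface ${\bf x}(u,v)$ put $E=\langle{\bf x}_u,{\bf x}_u\rangle$, $F=\langle{\bf x}_u,{\bf x}_v\rangle$, $G=\langle{\bf x}_v,{\bf x}_v\rangle$. The surface is spacelike if $EG-F^2>0$ and timelike if $EG-F^2<0$. **Helicoidal surfaces.** Let $c>0$ be a constant and $\varepsilon=\pm1$. A helicoidal surface is generated by rotating a smooth profile curve $\beta$ lying in a hyperplane about an $(n-2)$-plane and simultaneously translating it along a line $\ell$ (parallel to that $(n-2)$-plane and not meeting $\beta$). $u$ is the arc length parameter of $\beta$, ranging over an interval. Type I ($\ell$ spanned by $e_n$): $\beta_I(u)=(x_1(u),0,x_3(u),\dots,x_n(u))$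 with $x_1'^2+x_3'^2+\cdots+x_{n-1}'^2-x_n'^2=\varepsilon$, and $${\bf x}_I(u,v)=(x_1(u)\cos v,\,x_1(u)\sin v,\,x_3(u),\dots,x_{n-1}(u),\,x_n(u)+cv).$$ Type II ($\ell$ spanned by $e_1$): $\beta_{II}(u)=(x_1(u),\dots,x_{n-2}(u),0,x_n(u))$ with $x_1'^2+\cdots+x_{n-2}'^2-x_n'^2=\varepsilon$, and $${\bf x}_{II}(u,v)=(x_1(u)+cv,\,x_2(u),\dots,x_{n-2}(u),\,x_n(u)\sinh v,\,x_n(u)\cosh v).$$ Type III ($\ell$ spanned by $\xi_{n-1}$): $\beta_{III}(u)=x_1(u)e_1+x_3(u)e_3+\cdots+x_{n-2}(u)e_{n-2}+x_{n-1}(u)\xi_{n-1}+x_n(u)\xi_n$ with $x_1'^2+\sum_{i=3}^{n-2}x_i'^2-2x_{n-1}'x_n'=\varepsilon$, and $${\bf x}_{III}(u,v)=x_1(u)e_1+\sqrt2\,v\,x_n(u)e_2+x_3(u)e_3+\cdots+x_{n-2}(u)e_{n-2}+(x_{n-1}(u)+v^2x_n(u)+cv)\xi_{n-1}+x_n(u)\xi_n.$$ In all types $v$ is a real parameter. The meridians are the curves $v=\text{const}$, with tangent ${\bf x}_u$ and $\langle{\bf x}_u,{\bf x}_u\rangle=\varepsilon$; they are spacelike if $\varepsilon=1$ and timelike if $\varepsilon=-1$. **Angle and loxodromes.** For spacelike vectors $x,y$ spanning a timelike subspace, the Lorentzian timelike angle $\theta$ is defined by $\langle x,y\rangle=\|x\|\|y\|\cosh\theta$.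 For a spacelike vector $x$ and a timelike vector $y$ spanning a timelike subspace, the Lorentzian timelike angle $\theta$ is defined by $\langle x,y\rangle=\|x\|\|y\|\sinh\theta$. A spacelike loxodrome on a timelike helicoidal surface is a spacelike curve $\alpha(u)={\bf x}(u,v(u))$ on it (with $v$ a smooth function of $u$) whose tangent vector $\alpha'(u)$ makes a constant Lorentzian timelike angle $\theta_0$ with the meridian direction ${\bf x}_u$ at every point, i.e. $\langle\alpha',{\bf x}_u\rangle=\|\alpha'\|\,\|{\bf x}_u\|\,\cosh\theta_0$ if $\varepsilon=1$ and $\langle\alpha',{\bf x}_u\rangle=\|\alpha'\|\,\|{\bf x}_u\|\,\sinh\theta_0$ if $\varepsilon=-1$. *)

theory Defs
  imports "HOL-Analysis.Analysis"
begin

text \<open>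
  Lorentzian $n$-space is the type \<open>real ^ 'n\<close> with $n$ = \<open>CARD('n)\<close>. The coordinates
  $x_1,\dots,x_n$ are numbered along the linear order of the index type.
\<close>

definition pos :: "'n::{finite,linorder} \<Rightarrow> nat" where
  "pos j = card {..j}"

definition lorentz :: "real ^ 'n::{finite,linorder} \<Rightarrow> real ^ 'n::{finite,linorder} \<Rightarrow> real" where
  "lorentz x y = (\<Sum>j\<in>UNIV. (if pos j = CARD('n) then - 1 else 1) * (x $ j) * (y $ j))"

definition lnorm :: "real ^ 'n::{finite,linorder} \<Rightarrow> real" where
  "lnorm x = sqrt \<bar>lorentz x x\<bar>"

definition spacelike :: "real ^ 'n::{finite,linorder} \<Rightarrow> bool" where
  "spacelike x \<longleftrightarrow> lorentz x x > 0 \<or> x = 0"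

definition bas :: "nat \<Rightarrow> real ^ 'n::{finite,linorder}" where
  "bas i = (\<chi> j. if pos j = i then 1 else 0)"

text \<open>The lightlike vectors $\xi_{n-1}$ and $\xi_n$.\<close>

definition xi_pred :: "real ^ 'n::{finite,linorder}" where
  "xi_pred = (1 / sqrt 2) *\<^sub>R (bas CARD('n) - bas (CARD('n) - 1))"

definition xi_last :: "real ^ 'n::{finite,linorder}" where
  "xi_last = (1 / sqrt 2) *\<^sub>R (bas CARD('n) + bas (CARD('n) - 1))"

text \<open>
  Parameter intervals need not be open, so derivatives are taken within the interval
  (one-sided at an endpoint that belongs to it).
\<close>

definition deriv_on :: "real set \<Rightarrow> (real \<Rightarrow> 'a::real_normed_vector) \<Rightarrow> real \<Rightarrow> 'a" where
  "deriv_on I f u = vector_derivative f (at u within I)"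

definition smooth_on :: "real set \<Rightarrow> (real \<Rightarrow> 'a::real_normed_vector) \<Rightarrow> bool" where
  "smooth_on I f \<longleftrightarrow>
     (\<exists>D :: nat \<Rightarrow> real \<Rightarrow> 'a. D 0 = f \<and>
        (\<forall>k. \<forall>u\<in>I. (D k has_vector_derivative D (Suc k) u) (at u within I)))"

text \<open>
  A surface is a map of $(u,v)$ in \<open>I \<times> UNIV\<close>.
\<close>

definition surf_u :: "real set \<Rightarrow> (real \<Rightarrow> real \<Rightarrow> real ^ 'n::{finite,linorder}) \<Rightarrow>
    real \<Rightarrow> real \<Rightarrow> real ^ 'n::{finite,linorder}" where
  "surf_u I X u v = deriv_on I (\<lambda>s. X s v) u"

definition surf_v :: "(real \<Rightarrow> real \<Rightarrow> real ^ 'n::{finite,linorder}) \<Rightarrow>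
    real \<Rightarrow> real \<Rightarrow> real ^ 'n::{finite,linorder}" where
  "surf_v X u v = deriv_on UNIV (X u) v"

definition timelike_surface ::
  "real set \<Rightarrow> (real \<Rightarrow> real \<Rightarrow> real ^ 'n::{finite,linorder}) \<Rightarrow> bool" where
  "timelike_surface I X \<longleftrightarrow>
     (\<forall>u\<in>I. \<forall>v.
        let E = lorentz (surf_u I X u v) (surf_u I X u v);
            F = lorentz (surf_u I X u v) (surf_v X u v);
            G = lorentz (surf_v X u v) (surf_v X u v)
        in E * G - F\<^sup>2 < 0)"

text \<open>
  In the profile curves and surfaces below, \<open>x i u\<close> is the component $x_i(u)$; components
  that do not occur in a formula (such as $x_2$ for type I) are irrelevant.
  In type III, \<open>x (n - 1)\<close> and \<open>x n\<close> are the components along $\xi_{n-1}$ and $\xi_n$.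
\<close>

definition beta_I :: "(nat \<Rightarrow> real \<Rightarrow> real) \<Rightarrow> real \<Rightarrow> real ^ 'n::{finite,linorder}" where
  "beta_I x u = x 1 u *\<^sub>R bas 1 + (\<Sum>i = 3..CARD('n). x i u *\<^sub>R bas i)"

definition surf_I :: "real \<Rightarrow> (nat \<Rightarrow> real \<Rightarrow> real) \<Rightarrow>
    real \<Rightarrow> real \<Rightarrow> real ^ 'n::{finite,linorder}" where
  "surf_I c x u v =
     (x 1 u * cos v) *\<^sub>R bas 1 + (x 1 u * sin v) *\<^sub>R bas 2
     + (\<Sum>i = 3..CARD('n) - 1. x i u *\<^sub>R bas i)
     + (x CARD('n) u + c * v) *\<^sub>R bas CARD('n)"

definition beta_II :: "(nat \<Rightarrow> real \<Rightarrow> real) \<Rightarrow> real \<Rightarrow> real ^ 'n::{finite,linorder}" where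
  "beta_II x u = (\<Sum>i = 1..CARD('n) - 2. x i u *\<^sub>R bas i) + x CARD('n) u *\<^sub>R bas CARD('n)"

definition surf_II :: "real \<Rightarrow> (nat \<Rightarrow> real \<Rightarrow> real) \<Rightarrow>
    real \<Rightarrow> real \<Rightarrow> real ^ 'n::{finite,linorder}" where
  "surf_II c x u v =
     (x 1 u + c * v) *\<^sub>R bas 1
     + (\<Sum>i = 2..CARD('n) - 2. x i u *\<^sub>R bas i)
     + (x CARD('n) u * sinh v) *\<^sub>R bas (CARD('n) - 1)
     + (x CARD('n) u * cosh v) *\<^sub>R bas CARD('n)"

definition beta_III :: "(nat \<Rightarrow> real \<Rightarrow> real) \<Rightarrow> real \<Rightarrow> real ^ 'n::{finite,linorder}" where
  "beta_III x u =
     x 1 u *\<^sub>R bas 1 + (\<Sum>i = 3..CARD('n) - 2. x i u *\<^sub>R bas i)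
     + x (CARD('n) - 1) u *\<^sub>R xi_pred + x CARD('n) u *\<^sub>R xi_last"

definition surf_III :: "real \<Rightarrow> (nat \<Rightarrow> real \<Rightarrow> real) \<Rightarrow>
    real \<Rightarrow> real \<Rightarrow> real ^ 'n::{finite,linorder}" where
  "surf_III c x u v =
     x 1 u *\<^sub>R bas 1 + (sqrt 2 * v * x CARD('n) u) *\<^sub>R bas 2
     + (\<Sum>i = 3..CARD('n) - 2. x i u *\<^sub>R bas i)
     + (x (CARD('n) - 1) u + v\<^sup>2 * x CARD('n) u + c * v) *\<^sub>R xi_pred
     + x CARD('n) u *\<^sub>R xi_last"

text \<open>
  Smooth, parametrized by arc length with causal sign $\varepsilon$, and not meeting the
  line spanned by \<open>d\<close> along which the surface is translated.
\<close>

definition profile_curve ::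
  "real set \<Rightarrow> real \<Rightarrow> real ^ 'n::{finite,linorder} \<Rightarrow> (real \<Rightarrow> real ^ 'n::{finite,linorder}) \<Rightarrow> bool" where
  "profile_curve I \<epsilon> d \<beta> \<longleftrightarrow>
     smooth_on I \<beta> \<and>
     (\<forall>u\<in>I. lorentz (deriv_on I \<beta> u) (deriv_on I \<beta> u) = \<epsilon>) \<and>
     (\<forall>u\<in>I. \<beta> u \<notin> span {d})"

text \<open>
  The curve $\alpha(u) = {\bf x}(u,v(u))$ is a spacelike loxodrome with angle $\theta_0$; the
  meridians are spacelike for $\varepsilon = 1$ and timelike for $\varepsilon = -1$. That
  $\alpha'$ and ${\bf x}_u$ span a timelike subspace is not required separately: on a
  timelike surface they span the tangent plane, which is timelike, unless they are parallel,
  i.e. unless $\alpha'={\bf x}_u$, and then the equation forces $\varepsilon=1$, $\theta_0=0$.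
\<close>

definition spacelike_loxodrome ::
  "real set \<Rightarrow> (real \<Rightarrow> real \<Rightarrow> real ^ 'n::{finite,linorder}) \<Rightarrow> real \<Rightarrow> real \<Rightarrow>
   (real \<Rightarrow> real) \<Rightarrow> (real \<Rightarrow> real ^ 'n::{finite,linorder}) \<Rightarrow> bool" where
  "spacelike_loxodrome I X \<epsilon> \<theta>0 v \<alpha> \<longleftrightarrow>
     smooth_on I v \<and>
     (\<forall>u\<in>I. \<alpha> u = X u (v u)) \<and>
     (\<forall>u\<in>I. spacelike (deriv_on I \<alpha> u)) \<and>
     (\<forall>u\<in>I. lorentz (deriv_on I \<alpha> u) (surf_u I X u (v u)) =
        lnorm (deriv_on I \<alpha> u) * lnorm (surf_u I X u (v u)) *
        (if \<epsilon> = 1 then cosh \<theta>0 else sinh \<theta>0))"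

end

theory Submission
  imports Defs
begin

text \<open>
  For all three types the coefficients of the first fundamental form depend on $u$ only, with
  $E = \varepsilon$. Squaring the angle condition for $\alpha' = {\bf x}_u + v'{\bf x}_v$ gives
  $(\Theta^2 G - F^2) v'^2 + 2 F (\Theta^2 - \varepsilon) v' + \varepsilon(\Theta^2 - \varepsilon) = 0$,
  a quadratic equation for $v'$ with discriminant $\sinh^2 2\theta_0\,(F^2 - \varepsilon G)$, since
  $4\Theta^2(\Theta^2 - \varepsilon) = \sinh^2 2\theta_0$. As the surface is timelike, the
  discriminant either vanishes identically ($\theta_0 = 0$) or is positive everywhere; in the
  latter case the continuity of $v'$ forces the same root to be chosen on the whole interval.
  Integrating $v'$ gives the formula.
\<close>

section \<open>Coordinates and the Lorentzian product\<close>

text \<open>A larger index has a strictly larger initial segment, so \<open>pos\<close> is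
  injective, and an injection into a set of the same size is onto. Hence \<open>bas 1\<close>, ...,
  \<open>bas CARD('n)\<close> are the standard basis, while \<open>bas i\<close> for any other
  \<open>i\<close> is the zero vector.\<close>

lemma bij_betw_pos: "bij_betw (pos :: 'n::{finite,linorder} \<Rightarrow> nat) UNIV {1..CARD('n)}"
proof -
  have "strict_mono (pos :: 'n \<Rightarrow> nat)"
    by (auto simp: strict_mono_def pos_def intro!: psubset_card_mono)
  then have inj: "inj (pos :: 'n \<Rightarrow> nat)"
    by (rule strict_mono_imp_inj_on)
  have "pos j \<in> {1..CARD('n)}" for j :: 'n
    unfolding pos_def by (auto simp: Suc_le_eq card_gt_0_iff intro: card_mono)
  then have "range (pos :: 'n \<Rightarrow> nat) = {1..CARD('n)}"
    by (intro card_subset_eq) (auto simp: card_image inj)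
  with inj show ?thesis by (simp add: bij_betw_def)
qed

text \<open>Exactly one coordinate has number \<open>i\<close>, so the defining sum has a single
  term. For \<open>k\<close> outside the index range \<open>bas k\<close> is zero, in agreement with
  the case \<open>i \<noteq> k\<close>.\<close>

lemma lorentz_bas:
  assumes "i \<in> {1..CARD('n)}"
  shows "lorentz (bas i) (bas k :: real ^ 'n::{finite,linorder}) =
    (if i = k then if i = CARD('n) then - 1 else 1 else 0)"
proof -
  obtain j0 :: 'n where j0: "pos j0 = i"
    using assms bij_betw_pos[where 'n='n] by (metis bij_betw_imp_surj_on imageE)
  have eq: "pos j = i \<longleftrightarrow> j = j0" for j
    using j0 bij_betw_pos[where 'n='n] by (metis bij_betw_imp_inj_on injD)
  have "lorentz (bas i) (bas k :: real ^ 'n::{finite,linorder}) =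
      (\<Sum>j\<in>UNIV. if j = j0 then if i = k then if i = CARD('n) then - 1 else 1 else 0 else 0)"
    unfolding lorentz_def bas_def by (intro sum.cong) (auto simp: eq[symmetric])
  then show ?thesis by simp
qed

lemma lorentz_commute: "lorentz x y = lorentz y x"
  unfolding lorentz_def by (simp add: mult_ac)

text \<open>Boundedness lets derivatives pass through the product with a fixed vector. This is how
  smoothness of a profile curve is handed down to its components.\<close>

lemma bounded_linear_lorentz: "bounded_linear (\<lambda>x. lorentz x y)"
  unfolding lorentz_def
  by (intro bounded_linear_sum bounded_linear_mult_const bounded_linear_const_mult bounded_linear_vec_nth)

lemma lorentz_add_left: "lorentz (x + y) z = lorentz x z + lorentz y z"
  and lorentz_diff_left: "lorentz (x - y) z = lorentz x z - lorentz y z"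
  and lorentz_scaleR_left: "lorentz (a *\<^sub>R x) z = a * lorentz x z"
  and lorentz_sum_left: "lorentz (\<Sum>i\<in>S. f i) z = (\<Sum>i\<in>S. lorentz (f i) z)"
proof -
  have "linear (\<lambda>x. lorentz x z)" for z :: "real ^ 'n::{finite,linorder}"
    using bounded_linear_lorentz bounded_linear.linear by blast
  note lin = this[of z]
  show "lorentz (x + y) z = lorentz x z + lorentz y z"
    "lorentz (x - y) z = lorentz x z - lorentz y z"
    "lorentz (a *\<^sub>R x) z = a * lorentz x z"
    "lorentz (\<Sum>i\<in>S. f i) z = (\<Sum>i\<in>S. lorentz (f i) z)"
    using linear_add[OF lin] linear_diff[OF lin] linear_scale[OF lin] linear_sum[OF lin] by simp_all
qed

lemma lorentz_add_right: "lorentz z (x + y) = lorentz z x + lorentz z y"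
  and lorentz_diff_right: "lorentz z (x - y) = lorentz z x - lorentz z y"
  and lorentz_scaleR_right: "lorentz z (a *\<^sub>R x) = a * lorentz z x"
  by (simp_all add: lorentz_commute[of z] lorentz_add_left lorentz_diff_left lorentz_scaleR_left)

lemma lorentz_zero_left [simp]: "lorentz 0 y = 0"
  by (simp add: lorentz_def)

lemmas lorentz_bilinear =
  lorentz_add_left lorentz_diff_left lorentz_scaleR_left
  lorentz_add_right lorentz_diff_right lorentz_scaleR_right

lemma lorentz_bas_sum:
  assumes "S \<subseteq> {1..CARD('n)}"
  shows "lorentz (\<Sum>i\<in>S. f i *\<^sub>R bas i) (bas k :: real ^ 'n::{finite,linorder}) =
      (if k \<in> S then if k = CARD('n) then - f k else f k else 0)"
    and "lorentz (bas k :: real ^ 'n::{finite,linorder}) (\<Sum>i\<in>S. f i *\<^sub>R bas i) =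
      (if k \<in> S then if k = CARD('n) then - f k else f k else 0)"
proof -
  have "finite S" using assms finite_subset by blast
  have "lorentz (\<Sum>i\<in>S. f i *\<^sub>R bas i) (bas k :: real ^ 'n::{finite,linorder}) =
      (\<Sum>i\<in>S. if i = k then if k = CARD('n) then - f k else f k else 0)"
    unfolding lorentz_sum_left using assms
    by (intro sum.cong) (auto simp: lorentz_scaleR_left lorentz_bas)
  then show "lorentz (\<Sum>i\<in>S. f i *\<^sub>R bas i) (bas k :: real ^ 'n::{finite,linorder}) =
      (if k \<in> S then if k = CARD('n) then - f k else f k else 0)"
    using \<open>finite S\<close> by simp
  then show "lorentz (bas k :: real ^ 'n::{finite,linorder}) (\<Sum>i\<in>S. f i *\<^sub>R bas i) =
      (if k \<in> S then if k = CARD('n) then - f k else f k else 0)"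
    by (simp add: lorentz_commute)
qed

section \<open>Products with the null vectors\<close>

text \<open>Both vectors combine the last two basis vectors, whose squares are 1 and -1: these
  cancel in the squares of the null vectors and add up in the mixed product. The bound on the
  dimension puts \<open>CARD('n) - 1\<close> into the index range.\<close>

lemma lorentz_xi:
  assumes "CARD('n) \<ge> 2"
  shows "lorentz xi_pred (xi_pred :: real ^ 'n::{finite,linorder}) = 0" "lorentz xi_last (xi_last :: real ^ 'n::{finite,linorder}) = 0"
    "lorentz xi_pred (xi_last :: real ^ 'n::{finite,linorder}) = - 1" "lorentz xi_last (xi_pred :: real ^ 'n::{finite,linorder}) = - 1"
  using assms by (auto simp: xi_pred_def xi_last_def lorentz_bilinear lorentz_bas)

lemma lorentz_xi_bas:
  assumes "k < CARD('n) - 1"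
  shows "lorentz xi_pred (bas k :: real ^ 'n::{finite,linorder}) = 0"
    "lorentz (bas k) (xi_pred :: real ^ 'n::{finite,linorder}) = 0"
    "lorentz xi_last (bas k :: real ^ 'n::{finite,linorder}) = 0" "lorentz (bas k) (xi_last :: real ^ 'n::{finite,linorder}) = 0"
  using assms
  by (auto simp: xi_pred_def xi_last_def lorentz_bilinear lorentz_bas lorentz_commute[of "bas k"])

lemma lorentz_xi_sum:
  assumes "S \<subseteq> {1..CARD('n) - 2}"
  shows "lorentz (\<Sum>i\<in>S. f i *\<^sub>R bas i) (xi_pred :: real ^ 'n::{finite,linorder}) = 0"
    "lorentz (xi_pred :: real ^ 'n::{finite,linorder}) (\<Sum>i\<in>S. f i *\<^sub>R bas i) = 0"
    "lorentz (\<Sum>i\<in>S. f i *\<^sub>R bas i) (xi_last :: real ^ 'n::{finite,linorder}) = 0"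
    "lorentz (xi_last :: real ^ 'n::{finite,linorder}) (\<Sum>i\<in>S. f i *\<^sub>R bas i) = 0"
proof -
  have "k < CARD('n) - 1" if "k \<in> S" for k using subsetD[OF assms that] by auto
  then show "lorentz (\<Sum>i\<in>S. f i *\<^sub>R bas i) (xi_pred :: real ^ 'n::{finite,linorder}) = 0"
    "lorentz (\<Sum>i\<in>S. f i *\<^sub>R bas i) (xi_last :: real ^ 'n::{finite,linorder}) = 0"
    by (simp_all add: lorentz_sum_left lorentz_scaleR_left lorentz_xi_bas)
  then show "lorentz (xi_pred :: real ^ 'n::{finite,linorder}) (\<Sum>i\<in>S. f i *\<^sub>R bas i) = 0"
    "lorentz (xi_last :: real ^ 'n::{finite,linorder}) (\<Sum>i\<in>S. f i *\<^sub>R bas i) = 0"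
    by (simp_all add: lorentz_commute)
qed

section \<open>Derivatives and smoothness on an interval\<close>

text \<open>An interval with interior points is connected and has more than one point, so each of
  its points, endpoints included, is a limit point. This makes derivatives within \<open>I\<close>
  unique, and so gives \<open>deriv_on\<close> its meaning.\<close>

lemma interval_trivial_limit:
  fixes I :: "real set"
  assumes "is_interval I" "interior I \<noteq> {}" "u \<in> I"
  shows "at u within I \<noteq> bot"
proof -
  have "I \<noteq> {u}" using assms(2) by auto
  then have "u islimpt I"
    using assms is_interval_connected_1 connected_imp_perfect by blast
  then show ?thesis by (simp add: trivial_limit_within)
qed

lemma deriv_on_eqI:
  assumes "is_interval I" "interior I \<noteq> {}" "u \<in> I"
    and "(f has_vector_derivative D) (at u within I)"
  shows "deriv_on I f u = D"
  unfolding deriv_on_def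
  using vector_derivative_within[OF interval_trivial_limit[OF assms(1-3)] assms(4)] .

lemma smooth_on_has_deriv_on:
  assumes "is_interval I" "interior I \<noteq> {}" "u \<in> I" "smooth_on I f"
  shows "(f has_vector_derivative deriv_on I f u) (at u within I)"
proof -
  obtain D where "D (0::nat) = f"
    "\<forall>k. \<forall>u\<in>I. (D k has_vector_derivative D (Suc k) u) (at u within I)"
    using assms(4) unfolding smooth_on_def by blast
  then have "(f has_vector_derivative D 1 u) (at u within I)"
    using assms(3) by force
  with deriv_on_eqI[OF assms(1-3) this] show ?thesis by simp
qed

lemma smooth_on_continuous:
  assumes "smooth_on I f" shows "continuous_on I f"
  using assms unfolding smooth_on_def
  by (metis continuous_on_eq_continuous_within has_vector_derivative_continuous)

text \<open>By uniqueness \<open>deriv_on I f\<close> agrees on \<open>I\<close> with the member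
  \<open>D 1\<close> of the tower of derivatives, which is continuous because it has the derivative
  \<open>D 2\<close>.\<close>

lemma smooth_on_continuous_deriv_on:
  assumes "is_interval I" "interior I \<noteq> {}" "smooth_on I f"
  shows "continuous_on I (deriv_on I f)"
proof -
  obtain D where D: "D (0::nat) = f"
    "\<forall>k. \<forall>u\<in>I. (D k has_vector_derivative D (Suc k) u) (at u within I)"
    using assms(3) unfolding smooth_on_def by blast
  have "deriv_on I f u = D 1 u" if "u \<in> I" for u
    using D that by (intro deriv_on_eqI assms) force+
  moreover have "continuous_on I (D 1)"
    using D(2) by (metis continuous_on_eq_continuous_within has_vector_derivative_continuous)
  ultimately show ?thesis by (simp cong: continuous_on_cong)
qed

lemma smooth_on_bounded_linear:
  assumes "bounded_linear L" "smooth_on I f"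
  shows "smooth_on I (\<lambda>u. L (f u))"
proof -
  obtain D where D: "D (0::nat) = f"
    "\<forall>k. \<forall>u\<in>I. (D k has_vector_derivative D (Suc k) u) (at u within I)"
    using assms(2) unfolding smooth_on_def by blast
  show ?thesis
    unfolding smooth_on_def
    using D bounded_linear.has_vector_derivative[OF assms(1)]
    by (intro exI[of _ "\<lambda>k u. L (D k u)"]) auto
qed

section \<open>From the angle condition to the integral formula\<close>

text \<open>Here \<open>w\<close> stands for v' and \<open>q\<close> for the square of the tangent
  vector. The quadratic equation for \<open>w\<close> is stated with its square completed, as (2 A w
  + B)^2 = B^2 - 4 A C, which postpones the division by A.\<close>

lemma loxodrome_quadratic:
  fixes \<epsilon> \<theta>0 \<Theta> F G q w :: real
  assumes \<epsilon>: "\<epsilon> = 1 \<or> \<epsilon> = - 1"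
    and \<Theta>: "\<Theta> = (if \<epsilon> = 1 then cosh \<theta>0 else sinh \<theta>0)"
    and q: "q = \<epsilon> + 2 * w * F + w\<^sup>2 * G" "q \<ge> 0"
    and eq: "\<epsilon> + w * F = sqrt q * \<Theta>"
  shows "(2 * (\<Theta>\<^sup>2 * G - F\<^sup>2) * w + 2 * F * (\<Theta>\<^sup>2 - \<epsilon>))\<^sup>2 =
    (sinh (2 * \<theta>0))\<^sup>2 * (F\<^sup>2 - \<epsilon> * G)"
proof -
  have \<epsilon>2: "\<epsilon> * \<epsilon> = 1" using \<epsilon> by auto
  have "(sinh (2 * \<theta>0))\<^sup>2 = 4 * ((sinh \<theta>0)\<^sup>2 * (cosh \<theta>0)\<^sup>2)"
    by (simp add: sinh_double power_mult_distrib)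
  \<comment> \<open>For \<epsilon> = 1 the factor \<Theta>^2 - \<epsilon> is sinh^2, for \<epsilon>
    = -1 it is cosh^2, so the product is the same in both cases.\<close>
  also have "(sinh \<theta>0)\<^sup>2 * (cosh \<theta>0)\<^sup>2 = \<Theta>\<^sup>2 * (\<Theta>\<^sup>2 - \<epsilon>)"
    using \<epsilon> \<Theta> cosh_square_eq[of \<theta>0] by auto
  finally have sinh: "(sinh (2 * \<theta>0))\<^sup>2 = 4 * (\<Theta>\<^sup>2 * (\<Theta>\<^sup>2 - \<epsilon>))" .
  have "(\<epsilon> + w * F)\<^sup>2 = q * \<Theta>\<^sup>2"
    unfolding eq using q(2) by (simp add: power_mult_distrib)
  \<comment> \<open>The constant term comes out as \<epsilon> \<Theta>^2 - \<epsilon>^2, which is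
    \<epsilon> (\<Theta>^2 - \<epsilon>).\<close>
  then have "(\<Theta>\<^sup>2 * G - F\<^sup>2) * w\<^sup>2 + 2 * F * (\<Theta>\<^sup>2 - \<epsilon>) * w + \<epsilon> * (\<Theta>\<^sup>2 - \<epsilon>) = 0"
    unfolding q(1) using \<epsilon>2 by (simp add: power2_eq_square algebra_simps)
  with sinh \<epsilon>2 show ?thesis by algebra
qed

text \<open>If the right-hand side is positive, \<open>r\<close> has no zero, and a continuous
  function without zeros on a connected set keeps its sign. If \<open>k = 0\<close>, then
  \<open>r\<close> vanishes and either sign serves. The constant \<open>k\<close> is kept apart from
  \<open>D\<close> because it will be sinh^2 of 2 \<theta>0, which alone decides between the two
  cases.\<close>

lemma constant_sign:
  fixes r D :: "real \<Rightarrow> real"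
  assumes "connected I" "continuous_on I r"
    and "\<And>u. u \<in> I \<Longrightarrow> (r u)\<^sup>2 = k * D u" "k = 0 \<or> (\<forall>u\<in>I. k * D u > 0)"
  shows "\<exists>s\<in>{1, - 1}. \<forall>u\<in>I. r u = s * sqrt (k * D u)"
proof (cases "k = 0")
  case True
  with assms(3) show ?thesis by auto
next
  case False
  then have nz: "r u \<noteq> 0" if "u \<in> I" for u using assms(3,4) that by fastforce
  have abs: "\<bar>r u\<bar> = sqrt (k * D u)" if "u \<in> I" for u
    using assms(3)[OF that] by (metis real_sqrt_abs)
  have "connected (r ` I)" using assms(1,2) connected_continuous_image by blast
  then have "(\<forall>u\<in>I. r u > 0) \<or> (\<forall>u\<in>I. r u < 0)"
    using nz unfolding connected_iff_interval
    by (smt (verit) imageE imageI)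
  then show ?thesis
  proof
    assume "\<forall>u\<in>I. r u > 0"
    then show ?thesis using abs by (intro bexI[of _ 1]) force+
  next
    assume "\<forall>u\<in>I. r u < 0"
    then show ?thesis using abs by (intro bexI[of _ "- 1"]) force+
  qed
qed

text \<open>This is the argument shared by the three types. The surface enters only through the
  chain rule and its first fundamental form. Since \<open>F\<close> and \<open>G\<close> do not
  depend on the second parameter, the angle condition determines v' by a formula free of v, so a
  plain integration suffices. The integrand \<open>g\<close> is left open so that each type can
  supply its own closed form.\<close>

lemma loxodrome_integral:
  fixes X :: "real \<Rightarrow> real \<Rightarrow> real ^ 'n::{finite,linorder}"
  assumes I: "is_interval I" "interior I \<noteq> {}" and u0: "u0 \<in> I" "v u0 = 0"
    and \<epsilon>: "\<epsilon> = 1 \<or> \<epsilon> = - 1"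
    and \<Theta>: "\<Theta> = (if \<epsilon> = 1 then cosh \<theta>0 else sinh \<theta>0)"
    and tl: "timelike_surface I X"
    and lox: "spacelike_loxodrome I X \<epsilon> \<theta>0 v \<alpha>"
    and E: "\<And>u w. u \<in> I \<Longrightarrow> lorentz (surf_u I X u w) (surf_u I X u w) = \<epsilon>"
    and F: "\<And>u w. u \<in> I \<Longrightarrow> lorentz (surf_u I X u w) (surf_v X u w) = F u"
    and G: "\<And>u w. u \<in> I \<Longrightarrow> lorentz (surf_v X u w) (surf_v X u w) = G u"
    and chain: "\<And>u. u \<in> I \<Longrightarrow> ((\<lambda>s. X s (v s)) has_vector_derivative
      surf_u I X u (v u) + deriv_on I v u *\<^sub>R surf_v X u (v u)) (at u within I)"
    and contF: "continuous_on I F" and contG: "continuous_on I G"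
    and A: "\<And>u. u \<in> I \<Longrightarrow> \<Theta>\<^sup>2 * G u - (F u)\<^sup>2 \<noteq> 0"
    and g: "\<And>s \<xi>. g s \<xi> = (- 2 * F \<xi> * (\<Theta>\<^sup>2 - \<epsilon>)
        + s * sqrt ((sinh (2 * \<theta>0))\<^sup>2 * ((F \<xi>)\<^sup>2 - \<epsilon> * G \<xi>)))
      / (2 * (\<Theta>\<^sup>2 * G \<xi> - (F \<xi>)\<^sup>2))"
  shows "\<exists>s\<in>{1, - 1}. \<forall>u\<in>I. \<alpha> u = X u (v u) \<and> v u = (LBINT \<xi>=u0..u. g s \<xi>)"
proof -
  define w where "w = deriv_on I v"
  have smooth: "smooth_on I v" using lox by (simp add: spacelike_loxodrome_def)
  have dv: "(v has_vector_derivative w u) (at u within I)" if "u \<in> I" for u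
    using smooth_on_has_deriv_on[OF I that smooth] by (simp add: w_def)
  have contw: "continuous_on I w"
    using smooth_on_continuous_deriv_on[OF I smooth] by (simp add: w_def)
  \<comment> \<open>With E = \<epsilon>, the timelike condition says that the factor F^2 -
    \<epsilon> G of the discriminant is positive.\<close>
  have EG: "\<epsilon> * G u - (F u)\<^sup>2 < 0" if "u \<in> I" for u
    using tl that E F G unfolding timelike_surface_def by (auto simp: Let_def)
  \<comment> \<open>This is the derivative of the quadratic polynomial at its root
    \<open>w u\<close>, hence a square root of the discriminant with a sign still to be
    determined.\<close>
  define r where "r u = 2 * (\<Theta>\<^sup>2 * G u - (F u)\<^sup>2) * w u + 2 * F u * (\<Theta>\<^sup>2 - \<epsilon>)" for u
  have r2: "(r u)\<^sup>2 = (sinh (2 * \<theta>0))\<^sup>2 * ((F u)\<^sup>2 - \<epsilon> * G u)" if u: "u \<in> I" for u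
  proof -
    define a b where "a = surf_u I X u (v u)" and "b = surf_v X u (v u)"
    have ab: "lorentz a a = \<epsilon>" "lorentz a b = F u" "lorentz b b = G u"
      unfolding a_def b_def by (fact E[OF u] F[OF u] G[OF u])+
    have ba: "lorentz b a = F u" using ab(2) by (subst lorentz_commute)
    \<comment> \<open>The curve is known to equal x(s, v(s)) only for s in \<open>I\<close>; this is
      enough for derivatives within \<open>I\<close>.\<close>
    have "(\<alpha> has_vector_derivative a + w u *\<^sub>R b) (at u within I)"
      using lox chain[OF u] unfolding a_def b_def w_def
      by (auto simp: spacelike_loxodrome_def intro: has_vector_derivative_transform[OF u, where f = "\<lambda>s. X s (v s)"])
    then have da: "deriv_on I \<alpha> u = a + w u *\<^sub>R b" by (rule deriv_on_eqI[OF I u])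
    define q where "q = lorentz (a + w u *\<^sub>R b) (a + w u *\<^sub>R b)"
    have q: "q = \<epsilon> + 2 * w u * F u + (w u)\<^sup>2 * G u"
      by (simp add: q_def lorentz_bilinear ab ba power2_eq_square algebra_simps)
    \<comment> \<open>A spacelike vector may be zero, so only \<open>q \<ge> 0\<close> results; this
      suffices for taking the root.\<close>
    have "spacelike (a + w u *\<^sub>R b)" using lox u da by (auto simp: spacelike_loxodrome_def)
    then have q0: "q \<ge> 0" by (auto simp: spacelike_def q_def)
    have "lorentz (a + w u *\<^sub>R b) a = lnorm (a + w u *\<^sub>R b) * lnorm a * \<Theta>"
      using lox u unfolding spacelike_loxodrome_def a_def \<Theta> da[unfolded a_def, symmetric] by blast
    moreover have "lorentz (a + w u *\<^sub>R b) a = \<epsilon> + w u * F u"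
      by (simp add: lorentz_bilinear ab ba)
    moreover have "lnorm a = 1" "lnorm (a + w u *\<^sub>R b) = sqrt q"
      using \<epsilon> q0 by (auto simp: lnorm_def ab q_def)
    ultimately have "\<epsilon> + w u * F u = sqrt q * \<Theta>" by simp
    then show ?thesis unfolding r_def by (rule loxodrome_quadratic[OF \<epsilon> \<Theta> q q0])
  qed
  have "\<exists>s\<in>{1, - 1}. \<forall>u\<in>I. r u = s * sqrt ((sinh (2 * \<theta>0))\<^sup>2 * ((F u)\<^sup>2 - \<epsilon> * G u))"
  proof (rule constant_sign)
    show "connected I" using I is_interval_connected by blast
    show "continuous_on I r"
      unfolding r_def by (intro continuous_intros contF contG contw)
    \<comment> \<open>By \<open>EG\<close> the radicand can vanish only through its constant
      factor.\<close>
    show "(sinh (2 * \<theta>0))\<^sup>2 = 0 \<or> (\<forall>u\<in>I. (sinh (2 * \<theta>0))\<^sup>2 * ((F u)\<^sup>2 - \<epsilon> * G u) > 0)"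
      using EG by auto
  qed (use r2 in auto)
  then obtain s where s: "s \<in> {1, - 1}"
    and rs: "\<And>u. u \<in> I \<Longrightarrow> r u = s * sqrt ((sinh (2 * \<theta>0))\<^sup>2 * ((F u)\<^sup>2 - \<epsilon> * G u))"
    by blast
  \<comment> \<open>Solving the definition of \<open>r\<close> for \<open>w\<close> divides by 2
    (\<Theta>^2 G - F^2), which is nonzero by \<open>A\<close>.\<close>
  have gw: "g s u = w u" if "u \<in> I" for u
    unfolding g rs[OF that, symmetric] r_def using A[OF that]
    by (simp add: field_simps)
  have "v u = (LBINT \<xi>=u0..u. g s \<xi>)" if u: "u \<in> I" for u
  proof -
    \<comment> \<open>The point \<open>u\<close> may lie on either side of \<open>u0\<close>, hence
      the minimum and maximum.\<close>
    have sub: "{min u0 u..max u0 u} \<subseteq> I"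
      using mem_is_interval_1_I[OF I(1) u0(1) u] mem_is_interval_1_I[OF I(1) u u0(1)] u0(1) u
      by (auto simp: min_le_iff_disj le_max_iff_disj)
    have "(LBINT \<xi>=u0..u. g s \<xi>) = v u - v u0"
    proof (rule interval_integral_FTC_finite)
      \<comment> \<open>Continuity of the integrand is inherited from v', with which it agrees on
        \<open>I\<close>.\<close>
      show "continuous_on {min u0 u..max u0 u} (g s)"
        by (rule continuous_on_eq[OF continuous_on_subset[OF contw sub]])
          (use gw subsetD[OF sub] in metis)
      show "(v has_vector_derivative g s x) (at x within {min u0 u..max u0 u})"
        if "min u0 u \<le> x" "x \<le> max u0 u" for x
      proof -
        have "x \<in> I" using subsetD[OF sub] that by simp
        then show ?thesis
          using has_vector_derivative_within_subset[OF dv sub] gw by simp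
      qed
    qed
    with u0 show ?thesis by simp
  qed
  with s lox show ?thesis unfolding spacelike_loxodrome_def by blast
qed

section \<open>First fundamental forms of the three types\<close>

lemma has_vector_derivative_scaleR_const:
  "(f has_real_derivative f') (at u within S) \<Longrightarrow>
    ((\<lambda>s. f s *\<^sub>R b) has_vector_derivative f' *\<^sub>R b) (at u within S)"
  by (auto intro!: derivative_eq_intros)

text \<open>The vector X_u is the rotated velocity of the profile curve, so it keeps the square
  \<epsilon>. The rotational part of X_v is orthogonal to X_u, so F comes only from the translation
  along the timelike axis, which explains the minus signs in F and G.\<close>

lemma surf_I_forms:
  fixes x :: "nat \<Rightarrow> real \<Rightarrow> real" and c :: real
  defines "X \<equiv> surf_I c x :: real \<Rightarrow> real \<Rightarrow> real ^ 'n::{finite,linorder}"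
  assumes I: "is_interval I" "interior I \<noteq> {}" and n: "CARD('n) \<ge> 3"
    and profile: "profile_curve I \<epsilon> d (beta_I x :: real \<Rightarrow> real ^ 'n::{finite,linorder})"
  shows "smooth_on I (x 1)" and "smooth_on I (x CARD('n))"
    and "u \<in> I \<Longrightarrow> lorentz (surf_u I X u w) (surf_u I X u w) = \<epsilon>"
    and "u \<in> I \<Longrightarrow> lorentz (surf_u I X u w) (surf_v X u w) = - c * deriv_on I (x CARD('n)) u"
    and "u \<in> I \<Longrightarrow> lorentz (surf_v X u w) (surf_v X u w) = (x 1 u)\<^sup>2 - c\<^sup>2"
    and "u \<in> I \<Longrightarrow> (v has_vector_derivative v') (at u within I) \<Longrightarrow>
      ((\<lambda>s. X s (v s)) has_vector_derivative
        surf_u I X u (v u) + v' *\<^sub>R surf_v X u (v u)) (at u within I)"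
proof -
  let ?n = "CARD('n)"
  let ?\<beta> = "beta_I x :: real \<Rightarrow> real ^ 'n::{finite,linorder}"
  have smooth: "smooth_on I (x i)" if i: "i = 1 \<or> i \<in> {3..?n}" for i
  proof -
    \<comment> \<open>Pairing with a basis vector extracts the component; the sign corrects the
      square -1 of the last basis vector.\<close>
    have "(if i = ?n then - 1 else 1) * lorentz (?\<beta> u) (bas i) = x i u" for u
      using i n by (auto simp: beta_I_def lorentz_bilinear lorentz_bas lorentz_bas_sum)
    moreover have "smooth_on I (\<lambda>u. (if i = ?n then - 1 else 1) * lorentz (?\<beta> u) (bas i))"
      using profile
      by (intro smooth_on_bounded_linear[OF bounded_linear_const_mult[OF bounded_linear_lorentz]])
        (simp add: profile_curve_def)
    ultimately show ?thesis by simp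
  qed
  then show "smooth_on I (x 1)" "smooth_on I (x ?n)" using n by auto
  define y where "y i = deriv_on I (x i)" for i
  have dx: "(x i has_real_derivative y i u) (at u within I)"
    if "i = 1 \<or> i \<in> {3..?n}" "u \<in> I" for i u
    using smooth_on_has_deriv_on[OF I that(2) smooth[OF that(1)]]
    by (simp add: y_def has_real_derivative_iff_has_vector_derivative)
  \<comment> \<open>The components untouched by the motion, orthogonal to the first, second and last
    axes. For n = 3 the sum is empty.\<close>
  define M where "M u = (\<Sum>i = 3..?n - 1. y i u *\<^sub>R bas i :: real ^ 'n::{finite,linorder})" for u
  have M: "lorentz (bas k) (M u) = 0" "lorentz (M u) (bas k) = 0" if "k \<in> {1, 2, ?n}" for k u
    using that n unfolding M_def by (auto simp: lorentz_bas_sum)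
  have tab: "lorentz (bas i) (bas k :: real ^ 'n::{finite,linorder}) =
      (if i = k then if i = ?n then - 1 else 1 else 0)" if "i \<in> {1, 2, ?n}" for i k
    using that n by (intro lorentz_bas) auto
  have ne: "1 \<noteq> ?n" "2 \<noteq> ?n" "?n \<noteq> 1" "?n \<noteq> 2" using n by auto
  note lor = lorentz_bilinear M tab ne
  define Xu where "Xu u w = (y 1 u * cos w) *\<^sub>R bas 1 + (y 1 u * sin w) *\<^sub>R bas 2
    + M u + y ?n u *\<^sub>R (bas ?n :: real ^ 'n::{finite,linorder})" for u w
  define Xv where "Xv u w = (- x 1 u * sin w) *\<^sub>R bas 1 + (x 1 u * cos w) *\<^sub>R bas 2
    + c *\<^sub>R (bas ?n :: real ^ 'n::{finite,linorder})" for u w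
  have chain: "((\<lambda>s. X s (v s)) has_vector_derivative Xu u (v u) + v' *\<^sub>R Xv u (v u)) (at u within I)"
    if u: "u \<in> I" and v: "(v has_vector_derivative v') (at u within I)" for u v v'
  proof -
    note v' = v[folded has_real_derivative_iff_has_vector_derivative]
    have "((\<lambda>s. X s (v s)) has_vector_derivative
        (y 1 u * cos (v u) - x 1 u * sin (v u) * v') *\<^sub>R bas 1
        + (y 1 u * sin (v u) + x 1 u * cos (v u) * v') *\<^sub>R bas 2
        + (\<Sum>i = 3..?n - 1. y i u *\<^sub>R bas i) + (y ?n u + c * v') *\<^sub>R bas ?n) (at u within I)"
      unfolding X_def surf_I_def
      by (intro has_vector_derivative_add has_vector_derivative_sum has_vector_derivative_scaleR_const)
        (use n u in \<open>auto intro!: derivative_eq_intros dx v'\<close>)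
    then show ?thesis by (simp add: Xu_def Xv_def M_def algebra_simps)
  qed
  \<comment> \<open>A meridian is the case of a constant second parameter, with v' = 0.\<close>
  have Xu: "surf_u I X u w = Xu u w" if "u \<in> I" for u w
    unfolding surf_u_def using chain[OF that has_vector_derivative_const, of w]
    by (intro deriv_on_eqI I that) simp
  have Xv: "surf_v X u w = Xv u w" for u w
    unfolding surf_v_def X_def surf_I_def Xv_def
    by (intro deriv_on_eqI) (auto intro!: derivative_eq_intros simp: algebra_simps)
  \<comment> \<open>The arc length condition in coordinates, to which the square of X_u will be
    reduced.\<close>
  have \<beta>: "(y 1 u)\<^sup>2 + lorentz (M u) (M u) - (y ?n u)\<^sup>2 = \<epsilon>" if u: "u \<in> I" for u
  proof -
    have split: "sum f {3..?n} = sum f {3..?n - 1} + f ?n" for f :: "nat \<Rightarrow> real ^ 'n::{finite,linorder}"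
      using n by (cases ?n) auto
    have "(?\<beta> has_vector_derivative y 1 u *\<^sub>R bas 1 + (\<Sum>i = 3..?n. y i u *\<^sub>R bas i)) (at u within I)"
      unfolding beta_I_def
      by (intro has_vector_derivative_add has_vector_derivative_sum has_vector_derivative_scaleR_const)
        (use n u in \<open>auto intro!: dx\<close>)
    then have "deriv_on I ?\<beta> u = y 1 u *\<^sub>R bas 1 + (M u + y ?n u *\<^sub>R bas ?n)"
      unfolding M_def split by (intro deriv_on_eqI I u)
    moreover have "lorentz (deriv_on I ?\<beta> u) (deriv_on I ?\<beta> u) = \<epsilon>"
      using profile u by (simp add: profile_curve_def)
    ultimately show ?thesis by (simp add: lor power2_eq_square del: One_nat_def)
  qed
  have trig: "(cos w)\<^sup>2 + (sin w)\<^sup>2 = 1" for w :: real by simp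
  show "lorentz (surf_u I X u w) (surf_u I X u w) = \<epsilon>" if "u \<in> I" for u w
    unfolding Xu[OF that] \<beta>[OF that, symmetric] Xu_def using trig[of w]
    by (simp add: lor del: One_nat_def sin_cos_squared_add sin_cos_squared_add2) algebra
  show "lorentz (surf_u I X u w) (surf_v X u w) = - c * deriv_on I (x CARD('n)) u" if "u \<in> I" for u w
    unfolding Xu[OF that] Xv Xu_def Xv_def
    by (simp add: lor y_def del: One_nat_def)
  show "lorentz (surf_v X u w) (surf_v X u w) = (x 1 u)\<^sup>2 - c\<^sup>2" for u w
    unfolding Xv Xv_def using trig[of w]
    by (simp add: lor del: One_nat_def sin_cos_squared_add sin_cos_squared_add2) algebra
  show "((\<lambda>s. X s (v s)) has_vector_derivative
      surf_u I X u (v u) + v' *\<^sub>R surf_v X u (v u)) (at u within I)"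
    if "u \<in> I" "(v has_vector_derivative v') (at u within I)"
    using chain[OF that] Xu[OF that(1)] Xv by simp
qed

text \<open>A boost in the plane of the last two coordinates replaces the rotation, and cosh^2 -
  sinh^2 = 1 replaces the trigonometric identity. The translation is now along a spacelike axis, so
  c enters F and G with a plus sign.\<close>

lemma surf_II_forms:
  fixes x :: "nat \<Rightarrow> real \<Rightarrow> real" and c :: real
  defines "X \<equiv> surf_II c x :: real \<Rightarrow> real \<Rightarrow> real ^ 'n::{finite,linorder}"
  assumes I: "is_interval I" "interior I \<noteq> {}" and n: "CARD('n) \<ge> 3"
    and profile: "profile_curve I \<epsilon> d (beta_II x :: real \<Rightarrow> real ^ 'n::{finite,linorder})"
  shows "smooth_on I (x 1)" and "smooth_on I (x CARD('n))"
    and "u \<in> I \<Longrightarrow> lorentz (surf_u I X u w) (surf_u I X u w) = \<epsilon>"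
    and "u \<in> I \<Longrightarrow> lorentz (surf_u I X u w) (surf_v X u w) = c * deriv_on I (x 1) u"
    and "u \<in> I \<Longrightarrow> lorentz (surf_v X u w) (surf_v X u w) = c\<^sup>2 + (x CARD('n) u)\<^sup>2"
    and "u \<in> I \<Longrightarrow> (v has_vector_derivative v') (at u within I) \<Longrightarrow>
      ((\<lambda>s. X s (v s)) has_vector_derivative
        surf_u I X u (v u) + v' *\<^sub>R surf_v X u (v u)) (at u within I)"
proof -
  let ?n = "CARD('n)"
  let ?\<beta> = "beta_II x :: real \<Rightarrow> real ^ 'n::{finite,linorder}"
  have smooth: "smooth_on I (x i)" if i: "i = ?n \<or> i \<in> {1..?n - 2}" for i
  proof -
    have "(if i = ?n then - 1 else 1) * lorentz (?\<beta> u) (bas i) = x i u" for u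
      using i n by (auto simp: beta_II_def lorentz_bilinear lorentz_bas lorentz_bas_sum)
    moreover have "smooth_on I (\<lambda>u. (if i = ?n then - 1 else 1) * lorentz (?\<beta> u) (bas i))"
      using profile
      by (intro smooth_on_bounded_linear[OF bounded_linear_const_mult[OF bounded_linear_lorentz]])
        (simp add: profile_curve_def)
    ultimately show ?thesis by simp
  qed
  then show "smooth_on I (x 1)" "smooth_on I (x ?n)" using n by auto
  define y where "y i = deriv_on I (x i)" for i
  have dx: "(x i has_real_derivative y i u) (at u within I)"
    if "i = ?n \<or> i \<in> {1..?n - 2}" "u \<in> I" for i u
    using smooth_on_has_deriv_on[OF I that(2) smooth[OF that(1)]]
    by (simp add: y_def has_real_derivative_iff_has_vector_derivative)
  define M where "M u = (\<Sum>i = 2..?n - 2. y i u *\<^sub>R bas i :: real ^ 'n::{finite,linorder})" for u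
  have M: "lorentz (bas k) (M u) = 0" "lorentz (M u) (bas k) = 0" if "k \<in> {1, ?n - 1, ?n}" for k u
    using that n unfolding M_def by (auto simp: lorentz_bas_sum)
  have tab: "lorentz (bas i) (bas k :: real ^ 'n::{finite,linorder}) =
      (if i = k then if i = ?n then - 1 else 1 else 0)" if "i \<in> {1, ?n - 1, ?n}" for i k
    using that n by (intro lorentz_bas) auto
  have ne: "1 \<noteq> ?n" "1 \<noteq> ?n - 1" "?n \<noteq> 1" "?n - 1 \<noteq> 1" "?n \<noteq> ?n - 1" "?n - 1 \<noteq> ?n"
    using n by auto
  note lor = lorentz_bilinear M tab ne
  define Xu where "Xu u w = y 1 u *\<^sub>R bas 1 + M u + (y ?n u * sinh w) *\<^sub>R bas (?n - 1)
    + (y ?n u * cosh w) *\<^sub>R (bas ?n :: real ^ 'n::{finite,linorder})" for u w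
  define Xv where "Xv u w = c *\<^sub>R bas 1 + (x ?n u * cosh w) *\<^sub>R bas (?n - 1)
    + (x ?n u * sinh w) *\<^sub>R (bas ?n :: real ^ 'n::{finite,linorder})" for u w
  have chain: "((\<lambda>s. X s (v s)) has_vector_derivative Xu u (v u) + v' *\<^sub>R Xv u (v u)) (at u within I)"
    if u: "u \<in> I" and v: "(v has_vector_derivative v') (at u within I)" for u v v'
  proof -
    note v' = v[folded has_real_derivative_iff_has_vector_derivative]
    have "((\<lambda>s. X s (v s)) has_vector_derivative
        (y 1 u + c * v') *\<^sub>R bas 1 + (\<Sum>i = 2..?n - 2. y i u *\<^sub>R bas i)
        + (y ?n u * sinh (v u) + x ?n u * cosh (v u) * v') *\<^sub>R bas (?n - 1)
        + (y ?n u * cosh (v u) + x ?n u * sinh (v u) * v') *\<^sub>R bas ?n) (at u within I)"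
      unfolding X_def surf_II_def
      by (intro has_vector_derivative_add has_vector_derivative_sum has_vector_derivative_scaleR_const)
        (use n u in \<open>auto intro!: derivative_eq_intros dx v'\<close>)
    then show ?thesis by (simp add: Xu_def Xv_def M_def algebra_simps)
  qed
  have Xu: "surf_u I X u w = Xu u w" if "u \<in> I" for u w
    unfolding surf_u_def using chain[OF that has_vector_derivative_const, of w]
    by (intro deriv_on_eqI I that) simp
  have Xv: "surf_v X u w = Xv u w" for u w
    unfolding surf_v_def X_def surf_II_def Xv_def
    by (intro deriv_on_eqI) (auto intro!: derivative_eq_intros simp: algebra_simps)
  have \<beta>: "(y 1 u)\<^sup>2 + lorentz (M u) (M u) - (y ?n u)\<^sup>2 = \<epsilon>" if u: "u \<in> I" for u
  proof -
    \<comment> \<open>The first component lies along the translation axis and is separated from the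
      fixed ones; \<open>n \<ge> 3\<close> makes the range nonempty.\<close>
    have split: "sum f {1..?n - 2} = f 1 + sum f {2..?n - 2}"
      for f :: "nat \<Rightarrow> real ^ 'n::{finite,linorder}"
      using n by (subst sum.atLeast_Suc_atMost) (auto simp: numeral_2_eq_2)
    have "(?\<beta> has_vector_derivative (\<Sum>i = 1..?n - 2. y i u *\<^sub>R bas i) + y ?n u *\<^sub>R bas ?n) (at u within I)"
      unfolding beta_II_def
      by (intro has_vector_derivative_add has_vector_derivative_sum has_vector_derivative_scaleR_const)
        (use n u in \<open>auto intro!: dx\<close>)
    then have "deriv_on I ?\<beta> u = y 1 u *\<^sub>R bas 1 + M u + y ?n u *\<^sub>R bas ?n"
      unfolding M_def split by (intro deriv_on_eqI I u)
    moreover have "lorentz (deriv_on I ?\<beta> u) (deriv_on I ?\<beta> u) = \<epsilon>"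
      using profile u by (simp add: profile_curve_def)
    ultimately show ?thesis by (simp add: lor power2_eq_square del: One_nat_def)
  qed
  have hyp: "(cosh w)\<^sup>2 = (sinh w)\<^sup>2 + 1" for w :: real by (rule cosh_square_eq)
  show "lorentz (surf_u I X u w) (surf_u I X u w) = \<epsilon>" if "u \<in> I" for u w
    unfolding Xu[OF that] \<beta>[OF that, symmetric] Xu_def using hyp[of w]
    by (simp add: lor del: One_nat_def) algebra
  show "lorentz (surf_u I X u w) (surf_v X u w) = c * deriv_on I (x 1) u" if "u \<in> I" for u w
    unfolding Xu[OF that] Xv Xu_def Xv_def
    by (simp add: lor y_def del: One_nat_def)
  show "lorentz (surf_v X u w) (surf_v X u w) = c\<^sup>2 + (x ?n u)\<^sup>2" for u w
    unfolding Xv Xv_def using hyp[of w]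
    by (simp add: lor del: One_nat_def) algebra
  show "((\<lambda>s. X s (v s)) has_vector_derivative
      surf_u I X u (v u) + v' *\<^sub>R surf_v X u (v u)) (at u within I)"
    if "u \<in> I" "(v has_vector_derivative v') (at u within I)"
    using chain[OF that] Xu[OF that(1)] Xv by simp
qed

text \<open>The rotation is parabolic: the terms in the second parameter along \<open>bas 2\<close>
  cancel against those along \<open>xi_pred\<close>, because the mixed product of the null vectors
  is -1. As \<open>xi_pred\<close> is null, the translation leaves no trace in G. The bound
  \<open>n \<ge> 4\<close> keeps \<open>bas 2\<close> apart from the two basis vectors that span the
  null pair.\<close>

lemma surf_III_forms:
  fixes x :: "nat \<Rightarrow> real \<Rightarrow> real" and c :: real
  defines "X \<equiv> surf_III c x :: real \<Rightarrow> real \<Rightarrow> real ^ 'n::{finite,linorder}"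
  assumes I: "is_interval I" "interior I \<noteq> {}" and n: "CARD('n) \<ge> 4"
    and profile: "profile_curve I \<epsilon> d (beta_III x :: real \<Rightarrow> real ^ 'n::{finite,linorder})"
  shows "smooth_on I (x CARD('n))"
    and "u \<in> I \<Longrightarrow> lorentz (surf_u I X u w) (surf_u I X u w) = \<epsilon>"
    and "u \<in> I \<Longrightarrow> lorentz (surf_u I X u w) (surf_v X u w) = - c * deriv_on I (x CARD('n)) u"
    and "u \<in> I \<Longrightarrow> lorentz (surf_v X u w) (surf_v X u w) = 2 * (x CARD('n) u)\<^sup>2"
    and "u \<in> I \<Longrightarrow> (v has_vector_derivative v') (at u within I) \<Longrightarrow>
      ((\<lambda>s. X s (v s)) has_vector_derivative
        surf_u I X u (v u) + v' *\<^sub>R surf_v X u (v u)) (at u within I)"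
proof -
  let ?n = "CARD('n)"
  let ?\<beta> = "beta_III x :: real \<Rightarrow> real ^ 'n::{finite,linorder}"
  have ne: "1 \<noteq> ?n" "2 \<noteq> ?n" "1 < ?n - 1" "2 < ?n - 1" "2 \<le> ?n" using n by auto
  note xi = lorentz_xi[where 'n = 'n, OF ne(5)] lorentz_xi_bas[OF ne(3)] lorentz_xi_bas[OF ne(4)]
  have smooth: "smooth_on I (x i)" if i: "i = 1 \<or> i \<in> {3..?n}" for i
  proof -
    \<comment> \<open>Since $\langle\xi_{n-1},\xi_n\rangle = -1$, each null component is minus the product with the other null vector.\<close>
    define b :: "real ^ 'n::{finite,linorder}" where
      "b = (if i = ?n then - xi_pred else if i = ?n - 1 then - xi_last else bas i)"
    have i': "i \<in> {1..?n}" "i \<noteq> ?n \<Longrightarrow> i \<noteq> ?n - 1 \<Longrightarrow> i < ?n - 1" using i n by auto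
    have "lorentz (?\<beta> u) b = x i u" for u
      using i i' n xi
      by (auto simp: b_def beta_III_def lorentz_bilinear lorentz_bas lorentz_bas_sum lorentz_xi_bas
          lorentz_xi_sum lorentz_scaleR_right[of _ "- 1", simplified])
    moreover have "smooth_on I (\<lambda>u. lorentz (?\<beta> u) b)"
      using profile
      by (intro smooth_on_bounded_linear[OF bounded_linear_lorentz]) (simp add: profile_curve_def)
    ultimately show ?thesis by simp
  qed
  then show "smooth_on I (x ?n)" using n by auto
  define y where "y i = deriv_on I (x i)" for i
  have dx: "(x i has_real_derivative y i u) (at u within I)"
    if "i = 1 \<or> i \<in> {3..?n}" "u \<in> I" for i u
    using smooth_on_has_deriv_on[OF I that(2) smooth[OF that(1)]]
    by (simp add: y_def has_real_derivative_iff_has_vector_derivative)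
  define M where "M u = (\<Sum>i = 3..?n - 2. y i u *\<^sub>R bas i :: real ^ 'n::{finite,linorder})" for u
  have M: "lorentz (bas k) (M u) = 0" "lorentz (M u) (bas k) = 0" if "k \<in> {1, 2}" for k u
    using that n unfolding M_def by (auto simp: lorentz_bas_sum)
  have Mxi: "lorentz xi_pred (M u) = 0" "lorentz (M u) xi_pred = 0"
    "lorentz xi_last (M u) = 0" "lorentz (M u) xi_last = 0" for u
    unfolding M_def by (simp_all add: lorentz_xi_sum)
  have tab: "lorentz (bas i) (bas k :: real ^ 'n::{finite,linorder}) =
      (if i = k then 1 else 0)" if "i \<in> {1, 2}" for i k
    using that n by (subst lorentz_bas) auto
  note lor = lorentz_bilinear M Mxi tab xi
  define Xu where "Xu u w = y 1 u *\<^sub>R bas 1 + (sqrt 2 * w * y ?n u) *\<^sub>R bas 2 + M u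
    + (y (?n - 1) u + w\<^sup>2 * y ?n u) *\<^sub>R xi_pred
    + y ?n u *\<^sub>R (xi_last :: real ^ 'n::{finite,linorder})" for u w
  define Xv where "Xv u w = (sqrt 2 * x ?n u) *\<^sub>R bas 2
    + (2 * w * x ?n u + c) *\<^sub>R (xi_pred :: real ^ 'n::{finite,linorder})" for u w
  have chain: "((\<lambda>s. X s (v s)) has_vector_derivative Xu u (v u) + v' *\<^sub>R Xv u (v u)) (at u within I)"
    if u: "u \<in> I" and v: "(v has_vector_derivative v') (at u within I)" for u v v'
  proof -
    note v' = v[folded has_real_derivative_iff_has_vector_derivative]
    have "((\<lambda>s. X s (v s)) has_vector_derivative
        y 1 u *\<^sub>R bas 1 + (sqrt 2 * v' * x ?n u + sqrt 2 * v u * y ?n u) *\<^sub>R bas 2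
        + (\<Sum>i = 3..?n - 2. y i u *\<^sub>R bas i)
        + (y (?n - 1) u + (2 * v u * v' * x ?n u + (v u)\<^sup>2 * y ?n u) + c * v') *\<^sub>R xi_pred
        + y ?n u *\<^sub>R xi_last) (at u within I)"
      unfolding X_def surf_III_def
      by (intro has_vector_derivative_add has_vector_derivative_sum has_vector_derivative_scaleR_const)
        (use n u in \<open>auto intro!: derivative_eq_intros dx v'\<close>)
    then show ?thesis by (simp add: Xu_def Xv_def M_def algebra_simps)
  qed
  have Xu: "surf_u I X u w = Xu u w" if "u \<in> I" for u w
    unfolding surf_u_def using chain[OF that has_vector_derivative_const, of w]
    by (intro deriv_on_eqI I that) simp
  have Xv: "surf_v X u w = Xv u w" for u w
    unfolding surf_v_def X_def surf_III_def Xv_def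
    by (intro deriv_on_eqI) (auto intro!: derivative_eq_intros simp: algebra_simps)
  \<comment> \<open>The null components contribute only their mixed product, in place of a
    difference of squares.\<close>
  have \<beta>: "(y 1 u)\<^sup>2 + lorentz (M u) (M u) - 2 * y (?n - 1) u * y ?n u = \<epsilon>" if u: "u \<in> I" for u
  proof -
    have "(?\<beta> has_vector_derivative y 1 u *\<^sub>R bas 1 + M u
        + y (?n - 1) u *\<^sub>R xi_pred + y ?n u *\<^sub>R xi_last) (at u within I)"
      unfolding beta_III_def M_def
      by (intro has_vector_derivative_add has_vector_derivative_sum has_vector_derivative_scaleR_const)
        (use n u in \<open>auto intro!: dx\<close>)
    then have "deriv_on I ?\<beta> u = y 1 u *\<^sub>R bas 1 + M u
        + y (?n - 1) u *\<^sub>R xi_pred + y ?n u *\<^sub>R xi_last"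
      by (intro deriv_on_eqI I u)
    moreover have "lorentz (deriv_on I ?\<beta> u) (deriv_on I ?\<beta> u) = \<epsilon>"
      using profile u by (simp add: profile_curve_def)
    ultimately show ?thesis
      by (simp add: lor power2_eq_square algebra_simps del: One_nat_def)
  qed
  show "lorentz (surf_u I X u w) (surf_u I X u w) = \<epsilon>" if "u \<in> I" for u w
    unfolding Xu[OF that] \<beta>[OF that, symmetric] Xu_def
    by (simp add: lor power2_eq_square algebra_simps del: One_nat_def)
  show "lorentz (surf_u I X u w) (surf_v X u w) = - c * deriv_on I (x CARD('n)) u" if "u \<in> I" for u w
    unfolding Xu[OF that] Xv Xu_def Xv_def
    by (simp add: lor y_def algebra_simps del: One_nat_def)
  show "lorentz (surf_v X u w) (surf_v X u w) = 2 * (x ?n u)\<^sup>2" for u w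
    unfolding Xv Xv_def
    by (simp add: lor power2_eq_square algebra_simps del: One_nat_def)
  show "((\<lambda>s. X s (v s)) has_vector_derivative
      surf_u I X u (v u) + v' *\<^sub>R surf_v X u (v u)) (at u within I)"
    if "u \<in> I" "(v has_vector_derivative v') (at u within I)"
    using chain[OF that] Xu[OF that(1)] Xv by simp
qed

section \<open>The parametrizations of the loxodromes\<close>

theorem theorem4p1:
  fixes x :: "nat \<Rightarrow> real \<Rightarrow> real"
    and v :: "real \<Rightarrow> real"
    and \<alpha> :: "real \<Rightarrow> real ^ 'n::{finite,linorder}"
    and I :: "real set"
    and c \<epsilon> \<theta>0 \<Theta> u0 :: real
    and n :: nat
  assumes "n = CARD('n)"
    and "c > 0"
    and "\<epsilon> = 1 \<or> \<epsilon> = - 1"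
    and "is_interval I" and "interior I \<noteq> {}"
    and "u0 \<in> I" and "v u0 = 0"
    and "\<Theta> = (if \<epsilon> = 1 then cosh \<theta>0 else sinh \<theta>0)"
  shows
    "(n \<ge> 3 \<and>
      profile_curve I \<epsilon> (bas n) (beta_I x :: real \<Rightarrow> real ^ 'n::{finite,linorder}) \<and>
      timelike_surface I (surf_I c x :: real \<Rightarrow> real \<Rightarrow> real ^ 'n::{finite,linorder}) \<and>
      spacelike_loxodrome I (surf_I c x) \<epsilon> \<theta>0 v \<alpha> \<and>
      (\<forall>\<xi>\<in>I. \<Theta>\<^sup>2 * ((x 1 \<xi>)\<^sup>2 - c\<^sup>2) - c\<^sup>2 * (deriv_on I (x n) \<xi>)\<^sup>2 \<noteq> 0)
      \<longrightarrow>
      (\<exists>s\<in>{1, - 1}. \<forall>u\<in>I.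
         \<alpha> u = (x 1 u * cos (v u)) *\<^sub>R bas 1 + (x 1 u * sin (v u)) *\<^sub>R bas 2
                + (\<Sum>i = 3..n - 1. x i u *\<^sub>R bas i) + (x n u + c * v u) *\<^sub>R bas n \<and>
         v u = (LBINT \<xi>=u0..u.
           (2 * c * deriv_on I (x n) \<xi> * (\<Theta>\<^sup>2 - \<epsilon>)
            + s * sqrt ((sinh (2 * \<theta>0))\<^sup>2 *
                (c\<^sup>2 * (\<epsilon> + (deriv_on I (x n) \<xi>)\<^sup>2) - \<epsilon> * (x 1 \<xi>)\<^sup>2)))
           / (2 * \<Theta>\<^sup>2 * ((x 1 \<xi>)\<^sup>2 - c\<^sup>2) - 2 * c\<^sup>2 * (deriv_on I (x n) \<xi>)\<^sup>2))))
     \<and>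
     (n \<ge> 3 \<and>
      profile_curve I \<epsilon> (bas 1) (beta_II x :: real \<Rightarrow> real ^ 'n::{finite,linorder}) \<and>
      timelike_surface I (surf_II c x :: real \<Rightarrow> real \<Rightarrow> real ^ 'n::{finite,linorder}) \<and>
      spacelike_loxodrome I (surf_II c x) \<epsilon> \<theta>0 v \<alpha> \<and>
      (\<forall>\<xi>\<in>I. \<Theta>\<^sup>2 * (c\<^sup>2 + (x n \<xi>)\<^sup>2) - c\<^sup>2 * (deriv_on I (x 1) \<xi>)\<^sup>2 \<noteq> 0)
      \<longrightarrow>
      (\<exists>s\<in>{1, - 1}. \<forall>u\<in>I.
         \<alpha> u = (x 1 u + c * v u) *\<^sub>R bas 1 + (\<Sum>i = 2..n - 2. x i u *\<^sub>R bas i)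
                + (x n u * sinh (v u)) *\<^sub>R bas (n - 1) + (x n u * cosh (v u)) *\<^sub>R bas n \<and>
         v u = (LBINT \<xi>=u0..u.
           (- 2 * c * deriv_on I (x 1) \<xi> * (\<Theta>\<^sup>2 - \<epsilon>)
            + s * sqrt ((sinh (2 * \<theta>0))\<^sup>2 *
                (c\<^sup>2 * ((deriv_on I (x 1) \<xi>)\<^sup>2 - \<epsilon>) - \<epsilon> * (x n \<xi>)\<^sup>2)))
           / (2 * \<Theta>\<^sup>2 * (c\<^sup>2 + (x n \<xi>)\<^sup>2) - 2 * c\<^sup>2 * (deriv_on I (x 1) \<xi>)\<^sup>2))))
     \<and>
     (n \<ge> 4 \<and>
      profile_curve I \<epsilon> xi_pred (beta_III x :: real \<Rightarrow> real ^ 'n::{finite,linorder}) \<and>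
      timelike_surface I (surf_III c x :: real \<Rightarrow> real \<Rightarrow> real ^ 'n::{finite,linorder}) \<and>
      spacelike_loxodrome I (surf_III c x) \<epsilon> \<theta>0 v \<alpha> \<and>
      (\<forall>\<xi>\<in>I. 2 * \<Theta>\<^sup>2 * (x n \<xi>)\<^sup>2 - c\<^sup>2 * (deriv_on I (x n) \<xi>)\<^sup>2 \<noteq> 0)
      \<longrightarrow>
      (\<exists>s\<in>{1, - 1}. \<forall>u\<in>I.
         \<alpha> u = x 1 u *\<^sub>R bas 1 + (sqrt 2 * v u * x n u) *\<^sub>R bas 2
                + (\<Sum>i = 3..n - 2. x i u *\<^sub>R bas i)
                + (x (n - 1) u + (v u)\<^sup>2 * x n u + c * v u) *\<^sub>R xi_pred
                + x n u *\<^sub>R xi_last \<and>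
         v u = (LBINT \<xi>=u0..u.
           (2 * c * deriv_on I (x n) \<xi> * (\<Theta>\<^sup>2 - \<epsilon>)
            + s * sqrt ((sinh (2 * \<theta>0))\<^sup>2 *
                (c\<^sup>2 * (deriv_on I (x n) \<xi>)\<^sup>2 - 2 * \<epsilon> * (x n \<xi>)\<^sup>2)))
           / (4 * \<Theta>\<^sup>2 * (x n \<xi>)\<^sup>2 - 2 * c\<^sup>2 * (deriv_on I (x n) \<xi>)\<^sup>2))))"
proof -
  note I = assms(4,5)
  have dv: "(v has_vector_derivative deriv_on I v u) (at u within I)"
    if "spacelike_loxodrome I X \<epsilon> \<theta>0 v \<alpha>" "u \<in> I" for X u
    using that smooth_on_has_deriv_on[OF I, of u v] by (simp add: spacelike_loxodrome_def)
  show ?thesis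
    \<comment> \<open>Read backwards, the definitions of the surfaces turn each claimed expression
      for \<alpha>(u) into x(u, v(u)), as in the conclusion of
      \<open>loxodrome_integral\<close>.\<close>
    unfolding assms(1) surf_I_def[symmetric] surf_II_def[symmetric] surf_III_def[symmetric]
    apply (intro conjI impI; elim conjE)
    subgoal premises hyps
    proof -
      note forms = surf_I_forms[OF I hyps(1,2)]
      show ?thesis
      \<comment> \<open>With F = -c x_n' and G = x_1^2 - c^2, the radicand factor F^2 - \<epsilon> G
        is c^2 (\<epsilon> + x_n'^2) - \<epsilon> x_1^2, and the proviso is \<Theta>^2 G - F^2
        \<noteq> 0.\<close>
      proof (rule loxodrome_integral[OF I assms(6,7,3,8) hyps(3,4) forms(3) forms(4) forms(5)
            forms(6)[OF _ dv[OF hyps(4)]]])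
        show "continuous_on I (\<lambda>\<xi>. - c * deriv_on I (x CARD('n)) \<xi>)"
          "continuous_on I (\<lambda>\<xi>. (x 1 \<xi>)\<^sup>2 - c\<^sup>2)"
          by (intro continuous_intros smooth_on_continuous smooth_on_continuous_deriv_on I forms(1,2))+
      qed (use hyps(5) in \<open>simp_all add: power_mult_distrib algebra_simps\<close>)
    qed
    subgoal premises hyps
    proof -
      note forms = surf_II_forms[OF I hyps(1,2)]
      show ?thesis
      \<comment> \<open>Here F = c x_1' and G = c^2 + x_n^2; the sign of F accounts for the opposite
        sign of the first term of the numerator.\<close>
      proof (rule loxodrome_integral[OF I assms(6,7,3,8) hyps(3,4) forms(3) forms(4) forms(5)
            forms(6)[OF _ dv[OF hyps(4)]]])
        show "continuous_on I (\<lambda>\<xi>. c * deriv_on I (x 1) \<xi>)"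
          "continuous_on I (\<lambda>\<xi>. c\<^sup>2 + (x CARD('n) \<xi>)\<^sup>2)"
          by (intro continuous_intros smooth_on_continuous smooth_on_continuous_deriv_on I forms(1,2))+
      qed (use hyps(5) in \<open>simp_all add: power_mult_distrib algebra_simps\<close>)
    qed
    subgoal premises hyps
    proof -
      note forms = surf_III_forms[OF I hyps(1,2)]
      show ?thesis
      \<comment> \<open>Here F = -c x_n' and G = 2 x_n^2, so c appears in the integrand only
        together with x_n'.\<close>
      proof (rule loxodrome_integral[OF I assms(6,7,3,8) hyps(3,4) forms(2) forms(3) forms(4)
            forms(5)[OF _ dv[OF hyps(4)]]])
        show "continuous_on I (\<lambda>\<xi>. - c * deriv_on I (x CARD('n)) \<xi>)"
          "continuous_on I (\<lambda>\<xi>. 2 * (x CARD('n) \<xi>)\<^sup>2)"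
          by (intro continuous_intros smooth_on_continuous smooth_on_continuous_deriv_on I forms(1))+
      qed (use hyps(5) in \<open>simp_all add: power_mult_distrib algebra_simps\<close>)
    qed
    done
qed

end
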